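(* Let $r \in \mathbb{Z}_{\ge 0}$. Then \[ \{L_1(r), \dotsc, L_{\lceil r/2 \rceil}(r)\} = \{F_{r+2} - F_i F_j ;\ i,j \in \mathbb{Z}_{\ge 0},\ i+j = r-1\}. \] More explicitly, if $1 \le m \le \lceil \frac{r}{2} \rceil$, then \[ L_m(r) = F_{r+2} - F_{2m-2-b}\, F_{r-2m+1+b}, \] where $b = 0$ if $m \le \lfloor \frac{r+3}{4} \rfloor$ or $r$ is even, and $b = 1$ if $m > \lfloor \frac{r+3}{4} \rfloor$ and $r$ is odd.
   Context: The Stern sequence $(s(n))_{n\ge 0}$ is defined by $s(0)=0$, $s(1)=1$, $s(2n)=s(n)$ and $s(2n+1)=s(n)+s(n+1)$ for all $n\ge 0$. For $r \ge 0$, the $r$th row of Stern's diatomic array is the list $s(2^r), s(2^r+1), \dotsc, s(2^{r+1})$. For $r\ge 0$ and $m\ge 1$, $L_m(r)$ denotes the $m$th largest distinct value occurring in the $r$th row (and $L_m(r)=-\infty$ if the row has fewer than $m$ distinct values). $F_n$ denotes the $n$th Fibonacci number, defined for all $n\in\mathbb{Z}$ by $F_0=0$, $F_1=1$, $F_n=F_{n-1}+F_{n-2}$. *)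

theory Defs
  imports Complex_Main "HOL-Number_Theory.Fib" "HOL-Library.Extended"
begin

function stern :: "nat \<Rightarrow> nat" where
  "stern n = (if n \<le> 1 then n
              else if even n then stern (n div 2)
              else stern (n div 2) + stern (n div 2 + 1))"
  by auto
termination
proof (relation "measure id", goal_cases)
  case (4 n)
  then have "n \<ge> 3" by (auto elim!: oddE)
  then show ?case by simp
qed auto

declare stern.simps [simp del]

lemma stern_0: "stern 0 = 0"
  by (simp add: stern.simps)

lemma stern_1: "stern 1 = 1"
  by (simp add: stern.simps)

lemma stern_even: "stern (2 * n) = stern n"
  by (cases "n = 0") (simp_all add: stern.simps [of "2 * n"])

lemma stern_odd: "stern (2 * n + 1) = stern n + stern (n + 1)"
  by (cases "n = 0") (simp_all add: stern_0 stern.simps [of "Suc (2 * n)"] stern.simps [of "Suc 0"])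

text \<open>The row includes both endpoints \<open>2 ^ r\<close> and \<open>2 ^ (r + 1)\<close>.\<close>

definition stern_row :: "nat \<Rightarrow> nat list" where
  "stern_row r = map stern [2 ^ r ..< 2 ^ (r + 1) + 1]"

text \<open>
  \<open>largest m r\<close> is $L_m(r)$, meaningful for \<open>m \<ge> 1\<close>.
  The distinct entries are listed in strictly decreasing order, so the $m$th largest one
  has list index \<open>m - 1\<close>; \<open>Minf\<close> is $-\infty$.
\<close>

definition largest :: "nat \<Rightarrow> nat \<Rightarrow> int extended" where
  "largest m r =
     (let vs = rev (sorted_list_of_set (set (stern_row r)))
      in if m \<le> length vs then Fin (int (vs ! (m - 1))) else Minf)"

text \<open>Fibonacci numbers at all integer indices, with \<open>F (- n) = (- 1) ^ (n + 1) * F n\<close>.\<close>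

definition fibz :: "int \<Rightarrow> int" where
  "fibz n = (if 0 \<le> n then int (fib (nat n))
             else (- 1) ^ (nat (- n) + 1) * int (fib (nat (- n))))"

lemma fibz_0: "fibz 0 = 0"
  by (simp add: fibz_def)

lemma fibz_1: "fibz 1 = 1"
  by (simp add: fibz_def)

lemma fibz_rec: "fibz n = fibz (n - 1) + fibz (n - 2)"
proof -
  consider "n \<ge> 2" | "n = 1" | "n = 0" | "n < 0" by linarith
  then show ?thesis
  proof cases
    case 1
    define k where "k = nat (n - 2)"
    have "n = int k + 2" using 1 by (simp add: k_def)
    then show ?thesis by (simp add: fibz_def nat_add_distrib fib_plus_2)
  next
    case 4
    define k where "k = nat (- n)"
    have "n = - int k" "k > 0" using 4 by (simp_all add: k_def)
    moreover have "nat (1 + int k) = k + 1" "nat (2 + int k) = k + 2" by simp_all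
    ultimately show ?thesis by (simp add: fibz_def fib_plus_2 algebra_simps)
  qed (simp_all add: fibz_def)
qed

end

theory Submission
  imports Defs
begin

text \<open>
  Adjacent entries of row \<open>r\<close> arise from \<open>(1, 1)\<close> by \<open>r\<close> mediant insertions. Keeping only the newer
  entry \<open>M\<close> and the older one \<open>m\<close> of such a pair, an insertion is either \<open>(M, m) \<mapsto> (M + m, M)\<close> or
  \<open>(M, m) \<mapsto> (M + m, m)\<close>. Using only the first kind gives \<open>F\<^bsub>r+2\<^esub>\<close>; using the second kind exactly once
  (not in the first step, where both agree) gives the values \<open>F\<^bsub>r+2\<^esub> - F\<^sub>i F\<^sub>j\<close> with \<open>i + j = r - 1\<close>, \<open>i > 0\<close>;
  using it more often gives at most
  \<open>F\<^bsub>r+2\<^esub> - F\<^bsub>r-2\<^esub>\<close> or again such a value. Since \<open>F\<^sub>i F\<^sub>j \<le> F\<^bsub>i+j-1\<^esub>\<close>, these values are the largest ones,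
  and d'Ocagne's identity sorts the products \<open>F\<^sub>i F\<^sub>j\<close>.
\<close>

section \<open>Fibonacci numbers with integer indices\<close>

text \<open>The range starts at \<open>-1\<close> because \<open>F_(-1) = 1\<close>; the index
  \<open>j - 1\<close> with \<open>j = 0\<close> occurs below.\<close>

lemma fibz_nonneg: "- 1 \<le> n \<Longrightarrow> 0 \<le> fibz n"
  by (cases "n = - 1") (auto simp: fibz_def)

lemma fibz_pos: "0 < n \<Longrightarrow> 0 < fibz n"
  by (auto simp: fibz_def intro: fib_neq_0_nat)

text \<open>This sign rule and the next come from \<open>F_(-n) = (-1)^(n+1) F_n\<close>; they
  decide the comparisons in \<open>fib_prod_less_Suc\<close>.\<close>

lemma fibz_pos_odd: "odd n \<Longrightarrow> 0 < fibz n"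
  by (cases "n > 0") (auto simp: fibz_def even_nat_iff intro: fib_neq_0_nat)

lemma fibz_neg_even: "even n \<Longrightarrow> n < 0 \<Longrightarrow> fibz n < 0"
  by (auto simp: fibz_def even_nat_iff intro: fib_neq_0_nat)

lemma fibz_add_2: "fibz (n + 2) = fibz (n + 1) + fibz n"
  using fibz_rec[of "n + 2"] by (simp add: add.commute)

lemma fibz_add: "fibz (int p + q + 1) = fibz (int p + 1) * fibz (q + 1) + fibz (int p) * fibz q"
proof (induction p arbitrary: q)
  case 0
  then show ?case by (simp add: fibz_0 fibz_1)
next
  case (Suc p)
  show ?case
    using Suc[of "q + 1"] fibz_add_2[of "int p"] fibz_add_2[of q]
    by (simp add: algebra_simps)
qed

text \<open>Raising \<open>i\<close> by one amounts, up to sign, to lowering \<open>j\<close> by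
  one; hence \<open>j\<close> is generalized in the induction.\<close>

lemma fibz_dOcagne:
  "fibz (int i + 1) * fibz j - fibz (int i) * fibz (j + 1) = (- 1) ^ i * fibz (j - int i)"
proof (induction i arbitrary: j)
  case 0
  then show ?case by (simp add: fibz_0 fibz_1)
next
  case (Suc i)
  show ?case
    using Suc[of "j - 1"] fibz_add_2[of "int i"] fibz_add_2[of "j - 1"]
    by (simp add: algebra_simps)
qed

text \<open>When the indices shifted by two are expanded, the terms \<open>F_i F_j\<close> cancel
  and the previous difference remains.\<close>

lemma fibz_dOcagne_2:
  "fibz (int i + 2) * fibz j - fibz (int i) * fibz (j + 2) = (- 1) ^ i * fibz (j - int i)"
  using fibz_dOcagne[of i j] fibz_add_2[of "int i"] fibz_add_2[of j]
  by (simp add: algebra_simps)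

lemma fibz_mono_Suc: "0 \<le> n \<Longrightarrow> fibz n \<le> fibz (n + 1)"
  using fibz_rec[of "n + 1"] fibz_nonneg[of "n - 1"] by simp

text \<open>For \<open>i > 0\<close> the addition formula gives
  \<open>F_(i+j-1) = F_i F_j + F_(i-1) F_(j-1)\<close> with a nonnegative last product.\<close>

lemma fibz_mult_le:
  assumes "0 \<le> i" "0 \<le> j" "1 \<le> i + j"
  shows "fibz i * fibz j \<le> fibz (i + j - 1)"
proof (cases "i = 0")
  case True
  then show ?thesis using assms fibz_nonneg[of "j - 1"] by (simp add: fibz_0)
next
  case False
  then have "0 \<le> fibz (i - 1)" "0 \<le> fibz (j - 1)" using assms by (auto intro: fibz_nonneg)
  then have "0 \<le> fibz (i - 1) * fibz (j - 1)" by simp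
  then show ?thesis using fibz_add[of "nat (i - 1)" "j - 1"] False assms by (simp add: algebra_simps)
qed

section \<open>Adjacent entries of a row\<close>

inductive adjacent :: "nat \<Rightarrow> int \<Rightarrow> int \<Rightarrow> bool" where
  start: "adjacent 0 1 1"
| keep_new: "adjacent t M m \<Longrightarrow> adjacent (Suc t) (M + m) M"
| keep_old: "adjacent t M m \<Longrightarrow> adjacent (Suc t) (M + m) m"

text \<open>The newer entry can stand on either side of the older one, so the order is
  forgotten.\<close>

definition stern_pair :: "nat \<Rightarrow> int \<Rightarrow> int \<Rightarrow> bool" where
  "stern_pair n M m \<longleftrightarrow>
     int (stern n) = M \<and> int (stern (n + 1)) = m \<or> int (stern n) = m \<and> int (stern (n + 1)) = M"

lemma stern_odd': "stern (Suc (2 * n)) = stern n + stern (Suc n)"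
  using stern_odd[of n] by simp

lemma stern_even': "stern (Suc (Suc (2 * n))) = stern (Suc n)"
  using stern_even[of "Suc n"] by simp

lemma adjacent_imp_stern_pair:
  "adjacent t M m \<Longrightarrow> \<exists>n. 2 ^ t \<le> n \<and> n < 2 ^ (t + 1) \<and> stern_pair n M m"
proof (induction rule: adjacent.induct)
  case start
  then show ?case using stern_1 stern_even[of 1]
    by (intro exI[of _ 1]) (simp add: stern_pair_def numeral_2_eq_2)
next
  case (keep_new t M m)
  then obtain n where n: "2 ^ t \<le> n" "n < 2 ^ (t + 1)" "stern_pair n M m" by blast
  \<comment> \<open>Positions \<open>2n\<close>, \<open>2n + 1\<close>, \<open>2n + 2\<close> carry
    the old pair with its mediant in the middle; which half keeps \<open>M\<close> depends on the
    side where \<open>M\<close> stood.\<close>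
  have "stern_pair (2 * n) (M + m) M \<or> stern_pair (Suc (2 * n)) (M + m) M"
    using n(3) by (auto simp: stern_pair_def stern_even stern_odd' stern_even')
  then show ?case
  proof
    assume "stern_pair (2 * n) (M + m) M"
    then show ?thesis using n by (intro exI[of _ "2 * n"]) auto
  next
    assume "stern_pair (Suc (2 * n)) (M + m) M"
    then show ?thesis using n by (intro exI[of _ "Suc (2 * n)"]) auto
  qed
next
  case (keep_old t M m)
  then obtain n where n: "2 ^ t \<le> n" "n < 2 ^ (t + 1)" "stern_pair n M m" by blast
  have "stern_pair (2 * n) (M + m) m \<or> stern_pair (Suc (2 * n)) (M + m) m"
    using n(3) by (auto simp: stern_pair_def stern_even stern_odd' stern_even')
  then show ?case
  proof
    assume "stern_pair (2 * n) (M + m) m"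
    then show ?thesis using n by (intro exI[of _ "2 * n"]) auto
  next
    assume "stern_pair (Suc (2 * n)) (M + m) m"
    then show ?thesis using n by (intro exI[of _ "Suc (2 * n)"]) auto
  qed
qed

lemma ex_adjacent_stern_pair:
  "2 ^ t \<le> n \<Longrightarrow> n < 2 ^ (t + 1) \<Longrightarrow> \<exists>M m. adjacent t M m \<and> stern_pair n M m"
proof (induction t arbitrary: n)
  case 0
  then have "n = 1" by simp
  then show ?case using adjacent.start stern_1 stern_even[of 1]
    by (intro exI[of _ 1]) (simp add: stern_pair_def numeral_2_eq_2)
next
  case (Suc t)
  define k where "k = n div 2"
  have "2 ^ t \<le> k" "k < 2 ^ (t + 1)" using Suc.prems by (auto simp: k_def)
  then obtain M m where a: "adjacent t M m" and p: "stern_pair k M m" using Suc.IH by blast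
  have "n = 2 * k \<or> n = Suc (2 * k)" by (auto simp: k_def)
  then have "stern_pair n (M + m) M \<or> stern_pair n (M + m) m"
    using p by (auto simp: stern_pair_def stern_even stern_odd' stern_even')
  then show ?case using adjacent.keep_new[OF a] adjacent.keep_old[OF a] by blast
qed

lemma stern_power_2: "stern (2 ^ k) = 1"
  by (induction k) (simp_all add: stern_1[simplified] stern_even)

lemma set_stern_row: "set (stern_row r) = stern ` {2 ^ r..<2 ^ (r + 1)}"
proof -
  have "set (stern_row r) = insert (stern (2 ^ (r + 1))) (stern ` {2 ^ r..<2 ^ (r + 1)})"
    by (simp add: stern_row_def atLeastLessThanSuc)
  also have "stern (2 ^ (r + 1)) = stern (2 ^ r)"
    by (simp only: stern_power_2)
  also have "insert (stern (2 ^ r)) (stern ` {2 ^ r..<2 ^ (r + 1)}) = stern ` {2 ^ r..<2 ^ (r + 1)}"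
    by (auto intro!: insert_absorb imageI)
  finally show ?thesis .
qed

lemma adjacent_in_row:
  assumes "adjacent r M m"
  shows "M \<in> int ` set (stern_row r)"
proof -
  obtain n where n: "2 ^ r \<le> n" "n < 2 ^ (r + 1)" "stern_pair n M m"
    using adjacent_imp_stern_pair[OF assms] by blast
  then have "M = int (stern n) \<or> M = int (stern (n + 1))" by (auto simp: stern_pair_def)
  moreover have "n \<in> {2 ^ r..<2 ^ (r + 1) + 1}" "n + 1 \<in> {2 ^ r..<2 ^ (r + 1) + 1}"
    using n by auto
  ultimately show ?thesis unfolding stern_row_def set_map set_upt by blast
qed

lemma row_cases:
  assumes "v \<in> set (stern_row r)"
  obtains M m where "adjacent r M m" "int v = M \<or> int v = m"
proof -
  obtain n where "v = stern n" "2 ^ r \<le> n" "n < 2 ^ (r + 1)"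
    using assms unfolding set_stern_row by auto
  then show ?thesis using ex_adjacent_stern_pair[of r n] that by (auto simp: stern_pair_def)
qed

section \<open>Values of a row\<close>

lemma adjacent_bounds:
  "adjacent t M m \<Longrightarrow> m \<le> M \<and> 0 < m \<and> m \<le> fibz (int t + 1) \<and> M \<le> fibz (int t + 2)"
proof (induction rule: adjacent.induct)
  case start
  then show ?case using fibz_add_2[of 0] by (simp add: fibz_0 fibz_1)
next
  case (keep_new t M m)
  then show ?case using fibz_add_2[of "int t + 1"] by (simp add: algebra_simps)
next
  case (keep_old t M m)
  then show ?case using fibz_add_2[of "int t + 1"] fibz_mono_Suc[of "int t + 1"]
    by (simp add: algebra_simps)
qed

definition near_max :: "nat \<Rightarrow> int \<Rightarrow> bool" where
  "near_max t M \<longleftrightarrow> (\<exists>i j. 0 \<le> i \<and> 0 \<le> j \<and> i + j = int t - 1 \<and> M = fibz (int t + 2) - fibz i * fibz j)"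

text \<open>
  The alternatives are: no step \<open>keep_old\<close> (except for an initial one, where both kinds agree), a single
  one at time \<open>k + 1\<close>, or at least two. The two inequalities in the last case are what the following
  steps preserve, whereas \<open>M\<close> itself need not be small immediately after the second \<open>keep_old\<close>.
\<close>

lemma adjacent_trichotomy:
  "adjacent t M m \<Longrightarrow>
     M = fibz (int t + 2) \<and> m = fibz (int t + 1) \<or>
     (\<exists>k j. 1 \<le> k \<and> t = k + 1 + j \<and> M = fibz (int t + 2) - fibz (int k) * fibz (int j) \<and>
        m = fibz (int t + 1) - fibz (int k) * fibz (int j - 1)) \<or>
     (near_max t M \<or> M \<le> fibz (int t + 2) - fibz (int t - 2)) \<and>
       M + m \<le> fibz (int t + 3) - fibz (int t - 1) \<and> 2 * M + m \<le> fibz (int t + 4) - fibz (int t)"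
  (is "_ \<Longrightarrow> ?none t M m \<or> ?one t M m \<or> ?many t M m")
proof (induction rule: adjacent.induct)
  case start
  then show ?case using fibz_add_2[of 0] by (simp add: fibz_0 fibz_1)
next
  case (keep_new t M m)
  from keep_new.IH show ?case
  proof (elim disjE)
    assume "?none t M m"
    then show ?case using fibz_add_2[of "int t + 1"] by (simp add: algebra_simps)
  next
    assume "?one t M m"
    then obtain k j where kj: "1 \<le> k" "t = k + 1 + j"
      "M = fibz (int t + 2) - fibz (int k) * fibz (int j)"
      "m = fibz (int t + 1) - fibz (int k) * fibz (int j - 1)" by blast
    have "?one (Suc t) (M + m) M"
      using kj fibz_add_2[of "int t + 1"] fibz_add_2[of "int j - 1"]
      by (intro exI[of _ k] exI[of _ "Suc j"]) (simp add: algebra_simps)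
    then show ?case by blast
  next
    assume m: "?many t M m"
    \<comment> \<open>The new sums are \<open>2M + m\<close> and \<open>3M + 2m\<close>; the latter
      is bounded by adding the two old inequalities.\<close>
    then have "?many (Suc t) (M + m) M"
      using fibz_add_2[of "int t + 3"] fibz_add_2[of "int t - 1"]
      by (simp add: algebra_simps)
    then show ?case by blast
  qed
next
  case (keep_old t M m)
  from keep_old.IH show ?case
  proof (elim disjE)
    assume n: "?none t M m"
    show ?case
    proof (cases "t = 0")
      case True
      then show ?thesis using n fibz_add_2[of 0] fibz_add_2[of 1] by (simp add: fibz_0 fibz_1)
    next
      case False
      \<comment> \<open>With \<open>j = 0\<close> the newer entry is still maximal, as
        \<open>F_0 = 0\<close>; the loss \<open>F_t\<close> shows only in the older one, through
        \<open>F_(-1) = 1\<close>.\<close>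
      then have "?one (Suc t) (M + m) m"
        using n fibz_add_2[of "int t + 1"] fibz_add_2[of "int t"] fibz_add_2[of "- 1"]
        by (intro exI[of _ t] exI[of _ 0]) (simp add: algebra_simps fibz_0 fibz_1)
      then show ?thesis by blast
    qed
  next
    assume "?one t M m"
    then obtain k j where kj: "1 \<le> k" "t = k + 1 + j"
      "M = fibz (int t + 2) - fibz (int k) * fibz (int j)"
      "m = fibz (int t + 1) - fibz (int k) * fibz (int j - 1)" by blast
    let ?F = "\<lambda>n. fibz (int n)"
    have rec: "fibz (int t + 2) = fibz (int t + 1) + ?F t" "?F j + fibz (int j - 1) = fibz (int j + 1)"
      "fibz (int t + 1) = ?F t + fibz (int t - 1)"
      "fibz (int t + 3) = fibz (int t + 2) + fibz (int t + 1)"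
      "fibz (int t + 4) = fibz (int t + 3) + fibz (int t + 2)"
      "fibz (int t + 5) = fibz (int t + 4) + fibz (int t + 3)"
      using fibz_add_2[of "int t"] fibz_add_2[of "int j - 1"] fibz_add_2[of "int t - 1"]
        fibz_add_2[of "int t + 1"] fibz_add_2[of "int t + 2"] fibz_add_2[of "int t + 3"]
      by (simp_all add: algebra_simps)
    have M: "M + m = fibz (int t + 3) - ?F k * fibz (int j + 1)"
      unfolding kj(3,4) rec(4) rec(2)[symmetric] by (simp add: algebra_simps)
    have old: "0 \<le> ?F k * fibz (int j - 1)"
      by (intro mult_nonneg_nonneg fibz_nonneg) auto
    have new: "0 \<le> ?F k * fibz (int j + 1)"
      by (intro mult_nonneg_nonneg fibz_nonneg) auto
    \<comment> \<open>The deficit \<open>F_k F_(j+1)\<close> of \<open>M + m\<close>, counted twice,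
      must cover \<open>F_(t-1)\<close>. The addition formula splits \<open>F_(t-1)\<close> into
      this product and one that is no larger.\<close>
    have "fibz (int k - 1) * ?F j \<le> ?F k * fibz (int j + 1)"
      using fibz_mono_Suc[of "int k - 1"] fibz_mono_Suc[of "int j"] kj(1)
      by (intro mult_mono fibz_nonneg) auto
    moreover have "fibz (int t - 1) = ?F k * fibz (int j + 1) + fibz (int k - 1) * ?F j"
      using fibz_add[of "k - 1" "int j"] kj(1,2) by (simp add: of_nat_diff algebra_simps)
    ultimately have "fibz (int t - 1) \<le> 2 * (?F k * fibz (int j + 1))" by simp
    then have "M + m + m \<le> fibz (int t + 4) - ?F t"
      "2 * (M + m) + m \<le> fibz (int t + 5) - fibz (int t + 1)"
      using M kj(4) rec old new by simp_all
    moreover have "near_max (Suc t) (M + m)" unfolding near_max_def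
      using M kj(2) by (intro exI[of _ "int k"] exI[of _ "int j + 1"]) (simp add: algebra_simps)
    ultimately have "?many (Suc t) (M + m) m" by (simp add: algebra_simps)
    then show ?case by blast
  next
    assume m: "?many t M m"
    \<comment> \<open>Since \<open>m \<le> M\<close>, the sums \<open>M + 2m\<close> and
      \<open>2M + 3m\<close> are at most those after \<open>keep_new\<close>.\<close>
    then have "?many (Suc t) (M + m) m"
      using fibz_add_2[of "int t + 3"] fibz_add_2[of "int t - 1"] adjacent_bounds[OF keep_old.hyps]
      by (simp add: algebra_simps)
    then show ?case by blast
  qed
qed

lemma adjacent_fibz: "adjacent t (fibz (int t + 2)) (fibz (int t + 1))"
proof (induction t)
  case 0
  then show ?case using adjacent.start fibz_add_2[of 0] by (simp add: fibz_0 fibz_1)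
next
  case (Suc t)
  show ?case using adjacent.keep_new[OF Suc] fibz_add_2[of "int t + 1"] by (simp add: algebra_simps)
qed

text \<open>The path consists of \<open>k\<close> steps \<open>keep_new\<close>, one
  \<open>keep_old\<close>, and \<open>j\<close> more \<open>keep_new\<close>.\<close>

lemma adjacent_one_keep_old:
  "adjacent (k + 1 + j) (fibz (int (k + 1 + j) + 2) - fibz (int k) * fibz (int j))
     (fibz (int (k + 1 + j) + 1) - fibz (int k) * fibz (int j - 1))"
proof (induction j)
  case 0
  show ?case using adjacent.keep_old[OF adjacent_fibz[of k]]
      fibz_add_2[of "int k + 1"] fibz_add_2[of "int k"] fibz_add_2[of "- 1"]
    by (simp add: algebra_simps fibz_0 fibz_1)
next
  case (Suc j)
  show ?case using adjacent.keep_new[OF Suc]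
      fibz_add_2[of "int (k + 1 + j) + 1"] fibz_add_2[of "int j - 1"]
    by (simp add: algebra_simps)
qed

lemma near_max_in_row:
  assumes "near_max r v"
  shows "v \<in> int ` set (stern_row r)"
proof -
  obtain i j where ij: "0 \<le> i" "0 \<le> j" "i + j = int r - 1" "v = fibz (int r + 2) - fibz i * fibz j"
    using assms by (auto simp: near_max_def)
  have "nat i + 1 + nat j = r" using ij by linarith
  then show ?thesis using adjacent_in_row[OF adjacent_one_keep_old[of "nat i" "nat j"]] ij by simp
qed

lemma row_near_max_or_le:
  assumes "v \<in> set (stern_row r)" "1 \<le> r"
  shows "near_max r (int v) \<or> int v \<le> fibz (int r + 2) - fibz (int r - 2)"
proof -
  obtain M m where a: "adjacent r M m" and v: "int v = M \<or> int v = m"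
    using row_cases[OF assms(1)] by blast
  \<comment> \<open>Older entries are at most \<open>F_(r+1) = F_(r+2) - F_r\<close>, hence below
    the same threshold.\<close>
  have "fibz (int r - 2) \<le> fibz (int r)"
    using fibz_rec[of "int r"] fibz_nonneg[of "int r - 1"] by simp
  then have small: "fibz (int r + 1) \<le> fibz (int r + 2) - fibz (int r - 2)"
    using fibz_add_2[of "int r"] by simp
  have "near_max r M \<or> M \<le> fibz (int r + 2) - fibz (int r - 2)"
    using adjacent_trichotomy[OF a]
  proof (elim disjE exE conjE)
    assume "M = fibz (int r + 2)"
    then have "near_max r M" unfolding near_max_def
      using assms(2) by (intro exI[of _ 0] exI[of _ "int r - 1"]) (simp add: fibz_0)
    then show ?thesis ..
  next
    fix k j
    assume "r = k + 1 + j" "M = fibz (int r + 2) - fibz (int k) * fibz (int j)"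
    then have "near_max r M" unfolding near_max_def
      by (intro exI[of _ "int k"] exI[of _ "int j"]) simp
    then show ?thesis ..
  qed auto
  then show ?thesis using v small adjacent_bounds[OF a] by auto
qed

lemma near_max_ge:
  assumes "near_max r v" "1 \<le> r"
  shows "fibz (int r + 2) - fibz (int r - 2) \<le> v"
proof (cases "r = 1")
  case True
  then show ?thesis using assms by (auto simp: near_max_def fibz_0 fibz_def)
next
  case False
  then show ?thesis using assms fibz_mult_le by (fastforce simp: near_max_def)
qed

section \<open>Sorting the products\<close>

text \<open>The index \<open>2m - 2 - b\<close> of the theorem.\<close>

definition fib_index :: "nat \<Rightarrow> nat \<Rightarrow> int" where
  "fib_index r m = 2 * int m - 2 - (if 4 * m \<le> r + 3 \<or> even r then 0 else 1)"

definition fib_prod :: "nat \<Rightarrow> nat \<Rightarrow> int" where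
  "fib_prod r m = fibz (fib_index r m) * fibz (int r - 1 - fib_index r m)"

lemma fib_index_bounds:
  assumes "1 \<le> m" "2 * m \<le> r + 1"
  shows "0 \<le> fib_index r m" "fib_index r m \<le> int r - 1"
  using assms by (auto simp: fib_index_def elim!: evenE oddE)

text \<open>With \<open>i\<close> the index for \<open>m\<close>, d'Ocagne's identity makes the
  difference \<open>(-1)^i F_(r-3-2i)\<close>, or \<open>(-1)^i F_(r-2-2i)\<close> in case 3, where
  the index grows by one only. In cases 1 and 3, \<open>i\<close> is even and the Fibonacci index
  odd. In cases 2 and 4 the latter is even: positive with \<open>i\<close> even, then negative with
  \<open>i\<close> odd.\<close>

lemma fib_prod_less_Suc:
  assumes "1 \<le> m" "2 * Suc m \<le> r + 1"
  shows "fib_prod r m < fib_prod r (Suc m)"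
proof -
  define i where "i = nat (fib_index r m)"
  have i: "fib_index r m = int i"
    using fib_index_bounds[of m r] assms by (simp add: i_def)
  consider "even r" | "odd r" "4 * Suc m \<le> r + 3" | "odd r" "4 * m \<le> r + 3" "r + 3 < 4 * Suc m"
    | "odd r" "r + 3 < 4 * m" by linarith
  then show ?thesis
  proof cases
    case 1
    then have s: "fib_index r (Suc m) = int i + 2" and im: "int i = 2 * int m - 2"
      using i by (auto simp: fib_index_def)
    have "even i" using im by presburger
    then show ?thesis
      using 1 fibz_dOcagne_2[of i "int r - 3 - int i"] fibz_pos_odd[of "int r - 3 - 2 * int i"]
      by (simp add: fib_prod_def i s algebra_simps)
  next
    case 2
    then have s: "fib_index r (Suc m) = int i + 2" and im: "int i = 2 * int m - 2"
      using i by (auto simp: fib_index_def)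
    have "even i" using im by presburger
    moreover have "0 < int r - 3 - 2 * int i" using 2 im by presburger
    ultimately show ?thesis
      using fibz_dOcagne_2[of i "int r - 3 - int i"] fibz_pos[of "int r - 3 - 2 * int i"]
      by (simp add: fib_prod_def i s algebra_simps)
  next
    case 3
    then have s: "fib_index r (Suc m) = int i + 1" and im: "int i = 2 * int m - 2"
      using i by (auto simp: fib_index_def)
    have "even i" using im by presburger
    then show ?thesis
      using 3 fibz_dOcagne[of i "int r - 2 - int i"] fibz_pos_odd[of "int r - 2 - 2 * int i"]
      by (simp add: fib_prod_def i s algebra_simps)
  next
    case 4
    then have s: "fib_index r (Suc m) = int i + 2" and im: "int i = 2 * int m - 3"
      using i by (auto simp: fib_index_def)
    have "odd i" using im by presburger
    moreover have "int r - 3 - 2 * int i < 0" using 4 im by presburger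
    ultimately show ?thesis
      using 4 fibz_dOcagne_2[of i "int r - 3 - int i"] fibz_neg_even[of "int r - 3 - 2 * int i"]
      by (simp add: fib_prod_def i s algebra_simps)
  qed
qed

lemma fib_prod_less:
  assumes "m < n" "1 \<le> m" "2 * n \<le> r + 1"
  shows "fib_prod r m < fib_prod r n"
  using assms
proof (induction n)
  case (Suc n)
  then show ?case using fib_prod_less_Suc[of n r] by (cases "m = n") fastforce+
qed simp

text \<open>For even \<open>r\<close>, one of \<open>i\<close>, \<open>j\<close> is even and serves.
  For odd \<open>r\<close> they have equal parity: the smaller serves if both are even, the larger
  if both are odd.\<close>

lemma ex_fib_index:
  assumes "0 \<le> i" "0 \<le> j" "i + j = int r - 1"
  shows "\<exists>m. 1 \<le> m \<and> 2 * m \<le> r + 1 \<and> (fib_index r m = i \<or> fib_index r m = j)"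
proof -
  have even_case: "\<exists>m. 1 \<le> m \<and> 2 * m \<le> r + 1 \<and> fib_index r m = k"
    if "even k" "0 \<le> k" "k \<le> int r - 1" "even r \<or> 2 * k \<le> int r - 1" for k
  proof -
    obtain n where n: "k = int n" using \<open>0 \<le> k\<close> by (elim nonneg_int_cases)
    then obtain d where "n = 2 * d" using \<open>even k\<close> by (auto elim: evenE)
    then show ?thesis using that n
      by (intro exI[of _ "Suc d"]) (auto simp: fib_index_def)
  qed
  have odd_case: "\<exists>m. 1 \<le> m \<and> 2 * m \<le> r + 1 \<and> fib_index r m = k"
    if "odd k" "0 \<le> k" "k \<le> int r - 1" "odd r" "int r - 1 \<le> 2 * k" for k
  proof -
    obtain n where n: "k = int n" using \<open>0 \<le> k\<close> by (elim nonneg_int_cases)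
    then obtain d where "n = 2 * d + 1" using \<open>odd k\<close> by (auto elim: oddE)
    moreover obtain s where "r = 2 * s + 1" using \<open>odd r\<close> by (elim oddE)
    ultimately have "fib_index r (d + 2) = k" "2 * (d + 2) \<le> r + 1"
      using that n by (simp_all add: fib_index_def) presburger
    then show ?thesis by (intro exI[of _ "d + 2"]) simp
  qed
  have parity: "even i \<longleftrightarrow> (even j \<longleftrightarrow> odd r)" using assms(3) by presburger
  consider "even r" "even i" | "even r" "even j" | "odd r" "even i" "even j" | "odd r" "odd i" "odd j"
    using parity by blast
  then show ?thesis
  proof cases
    case 1
    then show ?thesis using even_case[of i] assms by auto
  next
    case 2
    then show ?thesis using even_case[of j] assms by auto
  next
    case 3
    then show ?thesis using even_case[of i] even_case[of j] assms by (cases "i \<le> j") fastforce+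
  next
    case 4
    then show ?thesis using odd_case[of i] odd_case[of j] assms by (cases "j \<le> i") fastforce+
  qed
qed

lemma near_max_iff:
  "near_max r v \<longleftrightarrow> (\<exists>m. 1 \<le> m \<and> 2 * m \<le> r + 1 \<and> v = fibz (int r + 2) - fib_prod r m)"
proof
  assume "near_max r v"
  then obtain i j where ij: "0 \<le> i" "0 \<le> j" "i + j = int r - 1" "v = fibz (int r + 2) - fibz i * fibz j"
    by (auto simp: near_max_def)
  obtain m where m: "1 \<le> m" "2 * m \<le> r + 1" "fib_index r m = i \<or> fib_index r m = j"
    using ex_fib_index[OF ij(1-3)] by blast
  have "i = int r - 1 - j" "j = int r - 1 - i" using ij by simp_all
  then have "fib_prod r m = fibz i * fibz j" using m(3) by (auto simp: fib_prod_def mult.commute)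
  then show "\<exists>m. 1 \<le> m \<and> 2 * m \<le> r + 1 \<and> v = fibz (int r + 2) - fib_prod r m"
    using m ij by auto
next
  assume "\<exists>m. 1 \<le> m \<and> 2 * m \<le> r + 1 \<and> v = fibz (int r + 2) - fib_prod r m"
  then obtain m where "1 \<le> m" "2 * m \<le> r + 1" "v = fibz (int r + 2) - fib_prod r m"
    by blast
  then show "near_max r v"
    unfolding near_max_def fib_prod_def using fib_index_bounds[of m r]
    by (intro exI[of _ "fib_index r m"] exI[of _ "int r - 1 - fib_index r m"]) simp
qed

section \<open>The largest values\<close>

text \<open>A strictly sorted list is determined by its set, so the values of \<open>g\<close> form
  its upper end.\<close>

lemma rev_sorted_list_of_set_nth:
  fixes g :: "nat \<Rightarrow> 'a::linorder"
  assumes "finite V" "\<And>m n. m < n \<Longrightarrow> n < N \<Longrightarrow> g n < g m" "g ` {..<N} \<subseteq> V"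
    and "\<And>v n. v \<in> V - g ` {..<N} \<Longrightarrow> n < N \<Longrightarrow> v < g n" and "n < N"
  shows "n < length (rev (sorted_list_of_set V))" "rev (sorted_list_of_set V) ! n = g n"
proof -
  let ?B = "V - g ` {..<N}"
  have "sorted_wrt (<) (sorted_list_of_set ?B @ rev (map g [0..<N]))"
  proof -
    have "sorted_wrt (\<lambda>x y. y < x) (map g [0..<N])"
      using assms(2) by (auto simp: sorted_wrt_iff_nth_less)
    then show ?thesis using assms(1,4) by (auto simp: sorted_wrt_append sorted_wrt_rev)
  qed
  moreover have "set (sorted_list_of_set ?B @ rev (map g [0..<N])) = V"
    using assms(1,3) by (auto simp: atLeast0LessThan)
  ultimately have "sorted_list_of_set V = sorted_list_of_set ?B @ rev (map g [0..<N])"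
    using strict_sorted_equal[OF strict_sorted_list_of_set] assms(1) by (metis set_sorted_list_of_set)
  then show "n < length (rev (sorted_list_of_set V))" "rev (sorted_list_of_set V) ! n = g n"
    using assms(5) by (simp_all add: nth_append)
qed

lemma largest_eq:
  assumes "1 \<le> m" "2 * m \<le> r + 1"
  shows "largest m r = Fin (fibz (int r + 2) - fib_prod r m)"
proof -
  let ?V = "set (stern_row r)"
  let ?h = "\<lambda>n. fibz (int r + 2) - fib_prod r (Suc n)"
  let ?g = "\<lambda>n. nat (?h n)"
  let ?N = "(r + 1) div 2"
  have r: "1 \<le> r" using assms by simp
  have near: "near_max r (?h n)" if "n < ?N" for n
    unfolding near_max_iff using that by (intro exI[of _ "Suc n"]) auto
  \<comment> \<open>\<open>nat\<close> loses nothing, since \<open>?h n\<close> is an entry of the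
    row.\<close>
  have g: "int (?g n) = ?h n" "?g n \<in> ?V" if "n < ?N" for n
    using near_max_in_row[OF near[OF that]] by (auto simp del: of_nat_diff)
  have less: "?g n < ?g k" if "k < n" "n < ?N" for k n
  proof -
    have "fib_prod r (Suc k) < fib_prod r (Suc n)" using that by (intro fib_prod_less) auto
    then have "?h n < ?h k" by simp
    moreover have "0 \<le> ?h n" using g(1)[OF that(2)] by linarith
    ultimately show ?thesis by linarith
  qed
  have below: "v < ?g n" if "v \<in> ?V - ?g ` {..<?N}" "n < ?N" for v n
  proof -
    have "\<not> near_max r (int v)"
    proof
      assume "near_max r (int v)"
      then obtain k where k: "1 \<le> k" "2 * k \<le> r + 1" "int v = fibz (int r + 2) - fib_prod r k"
        by (auto simp: near_max_iff)
      then have "v = ?g (k - 1)" by simp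
      moreover have "k - 1 < ?N" using k by linarith
      ultimately show False using that by blast
    qed
    \<comment> \<open>The threshold \<open>F_(r+2) - F_(r-2)\<close> gives only a weak inequality;
      this excludes a tie.\<close>
    moreover have "int v \<noteq> ?h n" using calculation near[OF that(2)] by auto
    ultimately have "int v < ?h n"
      using row_near_max_or_le[of v r] near_max_ge[OF near[OF that(2)] r] r that(1) by force
    then show ?thesis using g(1)[OF that(2)] by linarith
  qed
  have n: "m - 1 < ?N" using assms by linarith
  have "?g ` {..<?N} \<subseteq> ?V" using g(2) by blast
  note nth = rev_sorted_list_of_set_nth[of ?V ?N ?g, OF _ less this below n, simplified]
  have "m \<le> length (rev (sorted_list_of_set ?V))" using nth(1) assms(1) by simp
  moreover have "int (rev (sorted_list_of_set ?V) ! (m - 1)) = ?h (m - 1)"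
    using nth(2) g(1)[OF n] by simp
  ultimately show ?thesis using assms(1) by (simp add: largest_def Let_def)
qed

theorem theorem1p1:
  fixes r :: nat
  shows "{largest m r | m. 1 \<le> m \<and> int m \<le> \<lceil>real r / 2\<rceil>} =
           {Fin (fibz (int r + 2) - fibz i * fibz j) | i j. 0 \<le> i \<and> 0 \<le> j \<and> i + j = int r - 1}
       \<and> (\<forall>m. 1 \<le> m \<and> int m \<le> \<lceil>real r / 2\<rceil> \<longrightarrow>
            (let b = (if int m \<le> \<lfloor>(real r + 3) / 4\<rfloor> \<or> even r then 0 else 1)
             in largest m r =
                  Fin (fibz (int r + 2) - fibz (2 * int m - 2 - b) * fibz (int r - 2 * int m + 1 + b))))"
proof -
  have range: "int m \<le> \<lceil>real r / 2\<rceil> \<longleftrightarrow> 2 * m \<le> r + 1" for m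
    by (simp add: le_ceiling_iff) linarith
  have quarter: "int m \<le> \<lfloor>(real r + 3) / 4\<rfloor> \<longleftrightarrow> 4 * m \<le> r + 3" for m
    by (simp add: le_floor_iff) linarith
  have "{largest m r | m. 1 \<le> m \<and> 2 * m \<le> r + 1} = Fin ` Collect (near_max r)"
    unfolding near_max_iff using largest_eq by (auto simp: image_iff) metis
  also have "\<dots> = {Fin (fibz (int r + 2) - fibz i * fibz j) | i j. 0 \<le> i \<and> 0 \<le> j \<and> i + j = int r - 1}"
    unfolding near_max_def by blast
  finally show ?thesis
    unfolding range quarter using largest_eq
    by (auto simp: Let_def fib_prod_def fib_index_def algebra_simps)
qed

end
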